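(* Let $X_1$ and $X_2$ be proper $\mathrm{CAT}(0)$ spaces, let $\Gamma$ be an abstract group acting properly discontinuously by isometries on $X_1$ and on $X_2$, and let $\rho_i:\Gamma\to \mathrm{Isom}(X_i)$, $i=1,2$, denote the induced homomorphisms. Suppose that there exists $\alpha\in\Gamma$ such that $\rho_i(\alpha)$ is a rank one isometry of $X_i$ for both $i=1,2$. If the diagonal action of $\Gamma$ on $X_1\times X_2$ given by $\rho=(\rho_1,\rho_2)$, $\rho(\gamma)=(\rho_1(\gamma),\rho_2(\gamma))$, is convex co-compact, then $\rho_1$ and $\rho_2$ have the same marked length spectrum up to scaling, i.e. there exists $\lambda>0$ such that $\ell(\rho_1(\gamma))=\lambda\,\ell(\rho_2(\gamma))$ for all $\gamma\in\Gamma$.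
   Context: $X_1\times X_2$ carries the product metric $d=\sqrt{d_1^2+d_2^2}$. A properly discontinuous isometric action of a group on a proper CAT(0) space $X$ is convex co-compact if there is a nonempty closed invariant convex subset $C\subset X$ with $C/\Gamma$ compact. For an isometry $g$ of $X$, the translation length is $\ell(g)=\inf_{x\in X} d(x,gx)$. An isometry $g$ is hyperbolic if $x\mapsto d(x,gx)$ attains its infimum and $g$ has no fixed point; then $g$ has an axis, a $g$-invariant complete geodesic line on which $d(x,gx)$ is minimal. A hyperbolic isometry $g$ is rank one if an axis $l_g$ has the contraction property: there is $K>0$ such that the nearest-point projection to $l_g$ of any metric ball in $X$ disjoint from $l_g$ has diameter at most $K$ (equivalently, $l_g$ does not bound a flat half-plane). *)

theory Defs
  imports "HOL-Analysis.Analysis" "HOL-Algebra.Group"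
begin

definition proper_space :: "'a::metric_space itself \<Rightarrow> bool" where
  "proper_space _ \<longleftrightarrow> (\<forall>(x::'a) r. compact (cball x r))"

definition geodesic_segment :: "(real \<Rightarrow> 'a::metric_space) \<Rightarrow> 'a \<Rightarrow> 'a \<Rightarrow> bool" where
  "geodesic_segment c x y \<longleftrightarrow> c 0 = x \<and> c (dist x y) = y \<and>
     (\<forall>s\<in>{0..dist x y}. \<forall>t\<in>{0..dist x y}. dist (c s) (c t) = \<bar>s - t\<bar>)"

definition geodesic_space :: "'a::metric_space itself \<Rightarrow> bool" where
  "geodesic_space _ \<longleftrightarrow> (\<forall>x y::'a. \<exists>c. geodesic_segment c x y)"

text \<open>A side of a geodesic triangle together with its comparison side in the Euclidean
  plane (modelled by complex): the side c from a to b, with comparison points a', b'.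
  The point c s corresponds to a' + (s / d(a,b)) (b' - a').\<close>
definition comparison_point :: "complex \<Rightarrow> complex \<Rightarrow> real \<Rightarrow> real \<Rightarrow> complex" where
  "comparison_point a' b' L s = a' + of_real (s / L) * (b' - a')"

definition CAT0 :: "'a::metric_space itself \<Rightarrow> bool" where
  "CAT0 T \<longleftrightarrow> geodesic_space T \<and>
    (\<forall>(x1::'a) x2 x3 c12 c23 c31 (x1'::complex) x2' x3'.
       geodesic_segment c12 x1 x2 \<and> geodesic_segment c23 x2 x3 \<and> geodesic_segment c31 x3 x1 \<and>
       dist x1' x2' = dist x1 x2 \<and> dist x2' x3' = dist x2 x3 \<and> dist x3' x1' = dist x3 x1 \<longrightarrow>
       (let S = {(c12, x1, x2, x1', x2'), (c23, x2, x3, x2', x3'), (c31, x3, x1, x3', x1')} in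
        \<forall>(c, a, b, a', b')\<in>S. \<forall>(e, p, q, p', q')\<in>S.
          \<forall>s\<in>{0..dist a b}. \<forall>t\<in>{0..dist p q}.
            dist (c s) (e t) \<le> dist (comparison_point a' b' (dist a b) s)
                                     (comparison_point p' q' (dist p q) t)))"

definition geod_convex :: "'a::metric_space set \<Rightarrow> bool" where
  "geod_convex C \<longleftrightarrow> (\<forall>x\<in>C. \<forall>y\<in>C. \<forall>c. geodesic_segment c x y \<longrightarrow> c ` {0..dist x y} \<subseteq> C)"

definition isometry :: "('a::metric_space \<Rightarrow> 'a) \<Rightarrow> bool" where
  "isometry g \<longleftrightarrow> bij g \<and> (\<forall>x y. dist (g x) (g y) = dist x y)"

definition transl_len :: "('a::metric_space \<Rightarrow> 'a) \<Rightarrow> real" where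
  "transl_len g = (INF x. dist x (g x))"

definition hyperbolic :: "('a::metric_space \<Rightarrow> 'a) \<Rightarrow> bool" where
  "hyperbolic g \<longleftrightarrow> (\<exists>x. dist x (g x) = transl_len g) \<and> (\<forall>x. g x \<noteq> x)"

definition geodesic_line :: "(real \<Rightarrow> 'a::metric_space) \<Rightarrow> bool" where
  "geodesic_line c \<longleftrightarrow> (\<forall>s t. dist (c s) (c t) = \<bar>s - t\<bar>)"

definition is_axis :: "('a::metric_space \<Rightarrow> 'a) \<Rightarrow> (real \<Rightarrow> 'a) \<Rightarrow> bool" where
  "is_axis g c \<longleftrightarrow> geodesic_line c \<and> g ` range c = range c \<and>
     (\<forall>t. dist (c t) (g (c t)) = transl_len g)"

definition nearest_proj :: "'a::metric_space set \<Rightarrow> 'a set \<Rightarrow> 'a set" where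
  "nearest_proj L B = {p\<in>L. \<exists>y\<in>B. dist y p = infdist y L}"

definition rank_one :: "('a::metric_space \<Rightarrow> 'a) \<Rightarrow> bool" where
  "rank_one g \<longleftrightarrow> hyperbolic g \<and>
     (\<exists>c. is_axis g c \<and> (\<exists>K>0. \<forall>x r. ball x r \<inter> range c = {} \<longrightarrow>
        (\<forall>p\<in>nearest_proj (range c) (ball x r). \<forall>q\<in>nearest_proj (range c) (ball x r). dist p q \<le> K)))"

definition isom_action :: "('g, 'm) monoid_scheme \<Rightarrow> ('g \<Rightarrow> 'a::metric_space \<Rightarrow> 'a) \<Rightarrow> bool" where
  "isom_action G \<rho> \<longleftrightarrow> group G \<and> (\<forall>g\<in>carrier G. isometry (\<rho> g)) \<and> \<rho> \<one>\<^bsub>G\<^esub> = id \<and>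
     (\<forall>g\<in>carrier G. \<forall>h\<in>carrier G. \<rho> (g \<otimes>\<^bsub>G\<^esub> h) = \<rho> g \<circ> \<rho> h)"

definition properly_discontinuous :: "('g, 'm) monoid_scheme \<Rightarrow> ('g \<Rightarrow> 'a::metric_space \<Rightarrow> 'a) \<Rightarrow> bool" where
  "properly_discontinuous G \<rho> \<longleftrightarrow>
     (\<forall>K. compact K \<longrightarrow> finite {g\<in>carrier G. \<rho> g ` K \<inter> K \<noteq> {}})"

text \<open>Convex co-compact: a properly discontinuous isometric action with a nonempty closed
  invariant geodesically convex C whose quotient C/G is compact, i.e. C is covered by the
  G-translates of a compact subset of C.\<close>
definition convex_cocompact :: "('g, 'm) monoid_scheme \<Rightarrow> ('g \<Rightarrow> 'a::metric_space \<Rightarrow> 'a) \<Rightarrow> bool" where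
  "convex_cocompact G \<rho> \<longleftrightarrow> isom_action G \<rho> \<and> properly_discontinuous G \<rho> \<and>
     (\<exists>C. C \<noteq> {} \<and> closed C \<and> geod_convex C \<and> (\<forall>g\<in>carrier G. \<rho> g ` C \<subseteq> C) \<and>
          (\<exists>K. compact K \<and> K \<subseteq> C \<and> C \<subseteq> (\<Union>g\<in>carrier G. \<rho> g ` K)))"

definition diag_action :: "('g \<Rightarrow> 'a \<Rightarrow> 'a) \<Rightarrow> ('g \<Rightarrow> 'b \<Rightarrow> 'b) \<Rightarrow> 'g \<Rightarrow> 'a \<times> 'b \<Rightarrow> 'a \<times> 'b" where
  "diag_action \<rho>1 \<rho>2 g p = (\<rho>1 g (fst p), \<rho>2 g (snd p))"

lemma dist_prod_check: "dist (a::'a::metric_space, b::'b::metric_space) (c, d) = sqrt ((dist a c)\<^sup>2 + (dist b d)\<^sup>2)"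
  by (simp add: dist_Pair_Pair)

end

theory Submission
  imports Defs
begin

text \<open>Let \<open>l\<^sub>1\<close> and \<open>l\<^sub>2\<close> be the translation lengths of \<open>\<alpha>\<close> on its axes, and let \<open>C\<close> be the invariant
  convex set with compact quotient. Proper discontinuity on the second factor bounds the first
  coordinate on the points of \<open>C\<close> whose second coordinate stays bounded. Translating by powers of
  \<open>\<alpha>\<close>, a point of \<open>C\<close> near (axis 1 at \<open>t\<^sub>1\<close>, axis 2 at \<open>t\<^sub>2\<close>) has \<open>t\<^sub>1\<close> within bounded distance of
  \<open>l\<^sub>1 / l\<^sub>2 * t\<^sub>2\<close>. Given \<open>z\<close> in \<open>C\<close>, move it by a power of \<open>\<alpha>\<close> or of its inverse so that its projections
  to both axes are far out on the same side. By the contraction property the geodesic in \<open>C\<close> from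
  the base point \<open>x\<close> follows both axes, so its slope is nearly \<open>l\<^sub>1 / l\<^sub>2\<close>; projections far out on
  opposite sides are excluded in the same way. Hence \<open>d\<^sub>1(x, z) - l\<^sub>1 / l\<^sub>2 * d\<^sub>2(x, z)\<close> is sublinear
  on \<open>C\<close>. Applying this to \<open>z = \<gamma>\<^sup>n x\<close> with \<open>n = 2\<^sup>k\<close>, and using that in a CAT(0) space the
  displacement of \<open>\<gamma>\<^sup>n\<close> divided by \<open>n\<close> converges to the translation length, gives
  the scaling constant \<open>l\<^sub>1 / l\<^sub>2\<close>.\<close>

section \<open>Contracting lines\<close>

lemma geodesic_lineD: "geodesic_line c \<Longrightarrow> dist (c s) (c t) = \<bar>s - t\<bar>"
  by (simp add: geodesic_line_def)

lemma geodesic_line_reverse: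
  assumes "geodesic_line c"
  shows "geodesic_line (\<lambda>t. c (- t))"
  using assms by (simp add: geodesic_line_def abs_minus_commute)

lemma range_reverse: "range (\<lambda>t::real. c (- t)) = range c"
proof -
  have "c t \<in> range (\<lambda>t. c (- t))" for t
    by (rule range_eqI[of _ _ "- t"]) simp
  then show ?thesis by auto
qed

text \<open>The interval is arbitrary, unlike in \<open>geodesic_segment\<close>, so that a piece of
  a path is again of this form without reparametrisation.\<close>

definition isometric_path :: "(real \<Rightarrow> 'a::metric_space) \<Rightarrow> real \<Rightarrow> real \<Rightarrow> bool" where
  "isometric_path \<gamma> a b \<longleftrightarrow> (\<forall>s\<in>{a..b}. \<forall>t\<in>{a..b}. dist (\<gamma> s) (\<gamma> t) = \<bar>s - t\<bar>)"

lemma isometric_pathD: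
  "isometric_path \<gamma> a b \<Longrightarrow> a \<le> s \<Longrightarrow> s \<le> b \<Longrightarrow> a \<le> t \<Longrightarrow> t \<le> b \<Longrightarrow> dist (\<gamma> s) (\<gamma> t) = \<bar>s - t\<bar>"
  by (simp add: isometric_path_def)

lemma isometric_path_mono:
  "isometric_path \<gamma> a b \<Longrightarrow> a \<le> a' \<Longrightarrow> b' \<le> b \<Longrightarrow> isometric_path \<gamma> a' b'"
  by (auto simp: isometric_path_def)

lemma geodesic_segment_path: "geodesic_segment \<gamma> x y \<Longrightarrow> isometric_path \<gamma> 0 (dist x y)"
  by (auto simp: isometric_path_def geodesic_segment_def)

text \<open>A relation on parameters: feet on one line are compared as real numbers, and a point may
  have several of them.\<close>

definition foot :: "(real \<Rightarrow> 'a::metric_space) \<Rightarrow> 'a \<Rightarrow> real \<Rightarrow> bool" where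
  "foot c y t \<longleftrightarrow> dist y (c t) = infdist y (range c)"

lemma foot_le: "foot c y t \<Longrightarrow> dist y (c t) \<le> dist y (c s)"
  unfolding foot_def by (metis infdist_le rangeI)

text \<open>Beyond the parameter range \<open>R\<close> the line is farther from \<open>y\<close>
  than \<open>c 0\<close> is, so a minimum over the compact interval is global.\<close>

lemma foot_exists:
  assumes "geodesic_line c"
  shows "\<exists>t. foot c y t"
proof -
  define R where "R = 2 * dist y (c 0)"
  have "continuous_on {-R..R} (\<lambda>t. dist y (c t))"
  proof (rule continuous_on_dist[OF continuous_on_const])
    show "continuous_on {-R..R} c"
      unfolding continuous_on_iff
      by (metis assms geodesic_lineD dist_real_def)
  qed
  then obtain t where t: "t \<in> {-R..R}" "\<And>s. s \<in> {-R..R} \<Longrightarrow> dist y (c t) \<le> dist y (c s)"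
    using continuous_attains_inf[of "{-R..R}" "\<lambda>t. dist y (c t)"] by (force simp: R_def)
  have le: "dist y (c t) \<le> dist y (c s)" for s
  proof (cases "s \<in> {-R..R}")
    case False
    have "dist y (c t) \<le> dist y (c 0)"
      using t(2)[of 0] by (simp add: R_def)
    also have "\<dots> \<le> dist y (c s)"
      using False dist_triangle2[of "c s" "c 0" y] geodesic_lineD[OF assms, of s 0]
      by (auto simp: R_def dist_commute)
    finally show ?thesis .
  qed (use t in auto)
  have "infdist y (range c) = dist y (c t)"
    by (rule antisym) (auto simp: infdist_def intro!: cINF_lower2 cINF_greatest le bdd_belowI2[of _ 0])
  then show ?thesis by (auto simp: foot_def)
qed

lemma foot_reverse: "foot (\<lambda>t. c (- t)) y t \<longleftrightarrow> foot c y (- t)"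
  by (simp add: foot_def range_reverse)

lemma foot_abs_le:
  assumes "geodesic_line c" "foot c y t" "dist y (c 0) \<le> D"
  shows "\<bar>t\<bar> \<le> 2 * D"
  using foot_le[OF assms(2), of 0] dist_triangle2[of "c t" "c 0" y] assms(3)
    geodesic_lineD[OF assms(1), of t 0]
  by (simp add: dist_commute)

lemma foot_translate:
  assumes "isometry g" "\<And>t. g (c t) = c (t + l)" "foot c y t"
  shows "foot c (g y) (t + l)"
proof -
  have g: "dist (g u) (g v) = dist u v" for u v
    using assms(1) by (simp add: isometry_def)
  have eq: "dist (g y) (c s) = dist y (c (s - l))" for s
    using g[of y "c (s - l)"] assms(2)[of "s - l"] by simp
  have "infdist (g y) (range c) = dist (g y) (c (t + l))"
  proof (rule antisym)
    show "dist (g y) (c (t + l)) \<le> infdist (g y) (range c)"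
      using foot_le[OF assms(3)] by (auto simp: infdist_def eq intro!: cINF_greatest)
  qed (auto intro: infdist_le)
  then show ?thesis by (simp add: foot_def)
qed

text \<open>The contraction clause of \<open>rank_one\<close> without the isometry, so that an axis
  can be reversed and its constant enlarged.\<close>

locale contracting_line =
  fixes c :: "real \<Rightarrow> 'a::metric_space" and K :: real
  assumes line: "geodesic_line c" and K_pos: "K > 0"
    and contraction: "\<And>x r p q. ball x r \<inter> range c = {} \<Longrightarrow>
      p \<in> nearest_proj (range c) (ball x r) \<Longrightarrow> q \<in> nearest_proj (range c) (ball x r) \<Longrightarrow> dist p q \<le> K"
begin

lemma reverse: "contracting_line (\<lambda>t. c (- t)) K"
  by unfold_locales (use geodesic_line_reverse[OF line] K_pos contraction in \<open>simp_all add: range_reverse\<close>)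

text \<open>The open ball about \<open>x\<close> whose radius is the distance to the line misses the
  line, so the contraction property applies to it.\<close>

lemma foot_ball:
  assumes "foot c y s" "foot c z t" "dist x y < infdist x (range c)" "dist x z < infdist x (range c)"
  shows "\<bar>s - t\<bar> \<le> K"
proof -
  let ?B = "ball x (infdist x (range c))"
  have "?B \<inter> range c = {}"
    by (auto simp: dist_commute) (metis dist_commute infdist_le linorder_not_le rangeI)
  moreover have "c s \<in> nearest_proj (range c) ?B" "c t \<in> nearest_proj (range c) ?B"
    using assms by (auto simp: nearest_proj_def foot_def)
  ultimately have "dist (c s) (c t) \<le> K" by (rule contraction)
  then show ?thesis by (simp add: geodesic_lineD[OF line])
qed

text \<open>Off the line, \<open>foot_ball\<close> applies with \<open>y\<close> as centre. On the
  line, \<open>y\<close> is its own foot, and a foot of \<open>z\<close> is at most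
  \<open>2 * dist y z\<close> away from it.\<close>

lemma foot_local:
  assumes "foot c y s"
  shows "\<exists>\<delta>>0. \<forall>z t. dist y z < \<delta> \<longrightarrow> foot c z t \<longrightarrow> \<bar>s - t\<bar> \<le> K"
proof (cases "infdist y (range c) > 0")
  case True
  then show ?thesis using foot_ball[OF assms, of _ _ y] by auto
next
  case False
  then have y: "dist y (c s) = 0"
    using assms infdist_nonneg[of y "range c"] unfolding foot_def by linarith
  show ?thesis
  proof (intro exI[of _ "K / 2"] conjI allI impI)
    fix z t assume z: "dist y z < K / 2" "foot c z t"
    have "dist (c s) (c t) \<le> dist y z + dist z (c t)"
      using y dist_triangle[of y "c t" z] by simp
    also have "\<dots> \<le> dist y z + dist z (c s)"
      using foot_le[OF z(2)] by simp
    also have "\<dots> \<le> K"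
      using y z(1) by (simp add: dist_commute)
    finally show "\<bar>s - t\<bar> \<le> K" by (simp add: geodesic_lineD[OF line])
  qed (use K_pos in simp)
qed

text \<open>Otherwise the balls about the two ends that just reach the line share a point of the
  path. Its foot is within \<open>K\<close> of both \<open>s\<close> and \<open>t\<close>, against
  the gap of more than \<open>2 * K\<close>.\<close>

lemma foot_far:
  assumes "isometric_path \<gamma> a b" "a \<le> b" "foot c (\<gamma> a) s" "foot c (\<gamma> b) t" "\<bar>s - t\<bar> > 2 * K"
  shows "infdist (\<gamma> a) (range c) + infdist (\<gamma> b) (range c) \<le> b - a"
proof (rule ccontr)
  let ?f = "\<lambda>y. infdist y (range c)"
  assume "\<not> ?thesis"
  then have lt: "b - a < ?f (\<gamma> a) + ?f (\<gamma> b)" by simp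
  have d: "dist (\<gamma> a) (\<gamma> b) = b - a"
    using isometric_pathD[OF assms(1), of a b] assms(2) by simp
  \<comment> \<open>Each end must lie in its own open ball. If one end were on the line, the other
    would be within \<open>b - a\<close> of the line, against \<open>lt\<close>.\<close>
  have pos: "?f u > 0" if "dist u v < ?f u + ?f v" "foot c u p" "foot c v q" "\<bar>p - q\<bar> > 2 * K" for u v p q
  proof (rule ccontr)
    assume "\<not> ?f u > 0"
    then have 0: "?f u = 0" using infdist_nonneg[of u "range c"] by linarith
    then have "?f v \<le> dist v u"
      using infdist_le[of "c p" "range c" v] that(2) by (simp add: foot_def)
    with that(1) 0 show False by (simp add: dist_commute)
  qed
  have fa: "?f (\<gamma> a) > 0" using pos[of "\<gamma> a" "\<gamma> b" s t] lt d assms by simp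
  have fb: "?f (\<gamma> b) > 0"
    using pos[of "\<gamma> b" "\<gamma> a" t s] lt d assms by (simp add: dist_commute abs_minus_commute)
  obtain m where m: "a \<le> m" "m \<le> b" "m - a < ?f (\<gamma> a)" "b - m < ?f (\<gamma> b)"
  proof (cases "a = b")
    case True
    then show ?thesis using that[of a] fa fb by simp
  next
    case False
    then have "max a (b - ?f (\<gamma> b)) < min b (a + ?f (\<gamma> a))" using fa fb lt assms(2) by auto
    then obtain m where "max a (b - ?f (\<gamma> b)) < m" "m < min b (a + ?f (\<gamma> a))"
      using dense by blast
    then show ?thesis using that[of m] by auto
  qed
  obtain r where r: "foot c (\<gamma> m) r" using foot_exists[OF line] by blast
  have "\<bar>s - r\<bar> \<le> K"
    using foot_ball[OF assms(3) r, of "\<gamma> a"] fa m isometric_pathD[OF assms(1), of a m] assms(2) by simp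
  moreover have "\<bar>t - r\<bar> \<le> K"
    using foot_ball[OF assms(4) r, of "\<gamma> b"] fb m isometric_pathD[OF assms(1), of b m] assms(2) by simp
  ultimately show False using assms(5) by linarith
qed

text \<open>The foot need not depend continuously on the point (uniqueness of feet is not assumed),
  but by \<open>foot_local\<close> its jumps are at most \<open>K\<close>.\<close>
lemma foot_coarse_IVT:
  assumes path: "isometric_path \<gamma> a b" and "a \<le> b"
    and p: "foot c (\<gamma> a) p" and q: "foot c (\<gamma> b) q" and "p \<le> A" "A \<le> q"
  shows "\<exists>s\<in>{a..b}. \<exists>r. foot c (\<gamma> s) r \<and> \<bar>r - A\<bar> \<le> K"
proof (cases "A = q")
  case True
  then show ?thesis using q \<open>a \<le> b\<close> K_pos by (intro bexI[of _ b] exI[of _ q]) auto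
next
  case False
  with \<open>A \<le> q\<close> have "A < q" by simp
  define S where "S = {s\<in>{a..b}. \<exists>r\<le>A. foot c (\<gamma> s) r}"
  define m where "m = Sup S"
  have aS: "a \<in> S" using assms by (auto simp: S_def)
  have bdd: "bdd_above S" by (auto simp: S_def intro!: bdd_aboveI[of _ b])
  have am: "a \<le> m" unfolding m_def by (rule cSup_upper[OF aS bdd])
  have mb: "m \<le> b" unfolding m_def using aS by (intro cSup_least) (auto simp: S_def)
  obtain r where r: "foot c (\<gamma> m) r" using foot_exists[OF line] by blast
  obtain \<delta> where "\<delta> > 0" and \<delta>: "\<And>z t. dist (\<gamma> m) z < \<delta> \<Longrightarrow> foot c z t \<Longrightarrow> \<bar>r - t\<bar> \<le> K"
    using foot_local[OF r] by blast
  have near: "\<bar>r - t\<bar> \<le> K" if "s \<in> {a..b}" "\<bar>m - s\<bar> < \<delta>" "foot c (\<gamma> s) t" for s t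
    using \<delta>[of "\<gamma> s" t] that isometric_pathD[OF path, of m s] am mb by simp
  obtain s where s: "s \<in> S" "m - \<delta> < s"
    using less_cSup_iff[of S "m - \<delta>"] aS bdd \<open>\<delta> > 0\<close> by (auto simp: m_def)
  have sm: "s \<le> m" unfolding m_def by (rule cSup_upper[OF s(1) bdd])
  obtain r' where "s \<in> {a..b}" "r' \<le> A" "foot c (\<gamma> s) r'"
    using s(1) by (auto simp: S_def)
  then have up: "r \<le> A + K" using near[of s r'] s(2) sm by auto
  have lo: "A - K \<le> r"
  proof (cases "m = b")
    case True
    then show ?thesis using near[of b q] q \<open>A < q\<close> \<open>\<delta> > 0\<close> \<open>a \<le> b\<close> by auto
  next
    case False
    \<comment> \<open>Parameters after the supremum \<open>m\<close> are outside \<open>S\<close>,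
      so all feet there exceed \<open>A\<close>; close to \<open>m\<close> such a foot is within
      \<open>K\<close> of \<open>r\<close>.\<close>
    define s' where "s' = min b (m + \<delta> / 2)"
    have s': "s' \<in> {a..b}" "m < s'" "\<bar>m - s'\<bar> < \<delta>"
      using False am mb \<open>\<delta> > 0\<close> by (auto simp: s'_def)
    obtain t where t: "foot c (\<gamma> s') t" using foot_exists[OF line] by blast
    have "s' \<notin> S" using s'(2) cSup_upper[OF _ bdd, of s'] by (auto simp: m_def)
    then have "A < t" using t s'(1) by (auto simp: S_def not_le)
    then show ?thesis using near[OF s'(1,3) t] by auto
  qed
  show ?thesis using r up lo am mb by (intro bexI[of _ m] exI[of _ r]) auto
qed

text \<open>Take three points of the path whose feet are about \<open>A - 5 * K\<close>, \<open>A\<close> and \<open>A + 5 * K\<close>. The balls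
  around them that just reach the line are disjoint, so the middle radius is counted twice
  in the length of the path, on top of the outer radii. The detour along the line shows that
  twice the middle radius is at most the distance of the outer feet.\<close>
lemma geodesic_near:
  assumes path: "isometric_path \<gamma> a b" and ab: "a \<le> b"
    and p: "foot c (\<gamma> a) p" and q: "foot c (\<gamma> b) q" and A: "p + 5 * K \<le> A" "A + 5 * K \<le> q"
  shows "\<exists>s\<in>{a..b}. dist (\<gamma> s) (c A) \<le> 7 * K"
proof -
  let ?f = "\<lambda>y. infdist y (range c)"
  \<comment> \<open>Choosing each point on the interval left by the previous choices guarantees
    \<open>s0 \<le> s \<le> s1\<close>.\<close>
  obtain s1 r1 where s1: "a \<le> s1" "s1 \<le> b" and r1: "foot c (\<gamma> s1) r1" "\<bar>r1 - (A + 5 * K)\<bar> \<le> K"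
    using foot_coarse_IVT[OF path ab p q, of "A + 5 * K"] A K_pos by auto
  have path1: "isometric_path \<gamma> a s1" using isometric_path_mono[OF path] s1 by simp
  obtain s0 r0 where s0: "a \<le> s0" "s0 \<le> s1" and r0: "foot c (\<gamma> s0) r0" "\<bar>r0 - (A - 5 * K)\<bar> \<le> K"
  proof -
    have "p \<le> A - 5 * K" "A - 5 * K \<le> r1" using A r1(2) K_pos by linarith+
    then show thesis
      using foot_coarse_IVT[OF path1 s1(1) p r1(1)] that by fastforce
  qed
  have path0: "isometric_path \<gamma> s0 s1" using isometric_path_mono[OF path1] s0 by simp
  obtain s r where s: "s0 \<le> s" "s \<le> s1" and r: "foot c (\<gamma> s) r" "\<bar>r - A\<bar> \<le> K"
  proof -
    have "r0 \<le> A" "A \<le> r1" using r0(2) r1(2) K_pos by linarith+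
    then show thesis
      using foot_coarse_IVT[OF path0 s0(2) r0(1) r1(1)] that by fastforce
  qed
  have "?f (\<gamma> s0) + ?f (\<gamma> s) \<le> s - s0"
    using foot_far[OF isometric_path_mono[OF path0] s(1) r0(1) r(1)] s r0(2) r(2) K_pos by auto
  moreover have "?f (\<gamma> s) + ?f (\<gamma> s1) \<le> s1 - s"
    using foot_far[OF isometric_path_mono[OF path0] s(2) r(1) r1(1)] s r1(2) r(2) K_pos by auto
  moreover have "s1 - s0 \<le> ?f (\<gamma> s0) + (r1 - r0) + ?f (\<gamma> s1)"
  proof -
    have "s1 - s0 = dist (\<gamma> s0) (\<gamma> s1)" using isometric_pathD[OF path0, of s0 s1] s0 by simp
    also have "\<dots> \<le> dist (\<gamma> s0) (c r0) + dist (c r0) (c r1) + dist (\<gamma> s1) (c r1)"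
      using dist_triangle[of "\<gamma> s0" "\<gamma> s1" "c r0"] dist_triangle[of "c r0" "\<gamma> s1" "c r1"]
      by (simp add: dist_commute)
    finally show ?thesis
      using r0 r1 K_pos by (simp add: foot_def geodesic_lineD[OF line])
  qed
  \<comment> \<open>The outer distances cancel, which leaves
    \<open>2 * ?f (\<gamma> s) \<le> r1 - r0 \<le> 12 * K\<close>.\<close>
  ultimately have "?f (\<gamma> s) \<le> 6 * K" using r0(2) r1(2) by linarith
  moreover have "dist (\<gamma> s) (c A) \<le> dist (\<gamma> s) (c r) + \<bar>r - A\<bar>"
    using dist_triangle[of "\<gamma> s" "c A" "c r"] by (simp add: geodesic_lineD[OF line])
  ultimately have "dist (\<gamma> s) (c A) \<le> 7 * K" using r by (simp add: foot_def)
  then show ?thesis using s s0 s1 by (intro bexI[of _ s]) auto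
qed

text \<open>\<open>geodesic_near\<close> gives a point of the geodesic near \<open>c A\<close>, but
  at an unknown time \<open>t\<close>. Since \<open>t\<close> and \<open>A\<close> are both nearly
  the distance from \<open>x\<close>, they differ by at most \<open>7 * K + D\<close>, so equal
  times can be compared.\<close>

lemma fellow_travel:
  assumes seg: "geodesic_segment \<gamma> x z" and D: "dist x (c 0) \<le> D" and q: "foot c z q"
    and s: "0 \<le> s" "s \<le> q - 12 * K - 3 * D"
  shows "s \<le> dist x z" and "dist (\<gamma> s) (c s) \<le> 14 * K + 5 * D"
proof -
  have path: "isometric_path \<gamma> 0 (dist x z)" using geodesic_segment_path[OF seg] .
  have e: "\<gamma> 0 = x" "\<gamma> (dist x z) = z" using seg by (auto simp: geodesic_segment_def)
  have D0: "0 \<le> D" using D zero_le_dist[of x "c 0"] by linarith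
  obtain p where p: "foot c x p" using foot_exists[OF line] by blast
  have p2: "\<bar>p\<bar> \<le> 2 * D" by (rule foot_abs_le[OF line p D])
  have par: "\<exists>t\<in>{0..dist x z}. dist (\<gamma> t) (c A) \<le> 7 * K \<and> \<bar>t - A\<bar> \<le> 7 * K + D"
    if A: "2 * D + 5 * K \<le> A" "A + 5 * K \<le> q" for A
  proof -
    have "\<exists>t\<in>{0..dist x z}. dist (\<gamma> t) (c A) \<le> 7 * K"
      using geodesic_near[OF path zero_le_dist, of p q A] e p q p2 A by simp
    then obtain t where t: "0 \<le> t" "t \<le> dist x z" "dist (\<gamma> t) (c A) \<le> 7 * K"
      by auto
    have "dist x (\<gamma> t) = t" using isometric_pathD[OF path, of 0 t] t e by simp
    moreover have "dist (c 0) (c A) = A"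
      using geodesic_lineD[OF line, of 0 A] A D0 K_pos by simp
    ultimately have "\<bar>t - A\<bar> \<le> 7 * K + D"
      using t(3) D dist_triangle[of x "\<gamma> t" "c 0"] dist_triangle[of "c 0" "\<gamma> t" "c A"]
        dist_triangle[of "c 0" "c A" x] dist_triangle[of x "c A" "\<gamma> t"]
      by (simp add: dist_commute)
    with t show ?thesis by auto
  qed
  \<comment> \<open>The largest admissible \<open>A\<close> gives a time on the geodesic that is
    already beyond \<open>s\<close>.\<close>
  obtain t where "t \<le> dist x z" "\<bar>t - (q - 5 * K)\<bar> \<le> 7 * K + D"
    using par[of "q - 5 * K"] s D0 K_pos by auto
  then show le: "s \<le> dist x z" using s D0 by linarith
  have ds: "dist x (\<gamma> s) = s" using isometric_pathD[OF path, of 0 s] s le e by simp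
  show "dist (\<gamma> s) (c s) \<le> 14 * K + 5 * D"
  proof (cases "2 * D + 5 * K \<le> s")
    case True
    then obtain t where t: "0 \<le> t" "t \<le> dist x z" "dist (\<gamma> t) (c s) \<le> 7 * K" "\<bar>t - s\<bar> \<le> 7 * K + D"
      using par[of s] s D0 K_pos by auto
    have "dist (\<gamma> s) (\<gamma> t) = \<bar>s - t\<bar>" using isometric_pathD[OF path, of s t] s t le by simp
    then show ?thesis using t dist_triangle[of "\<gamma> s" "c s" "\<gamma> t"] D0 by linarith
  next
    case False
    have "dist (c 0) (c s) = s" using geodesic_lineD[OF line, of 0 s] s by simp
    then have "dist (\<gamma> s) (c s) \<le> s + D + s"
      using ds D dist_triangle[of "\<gamma> s" "c s" x] dist_triangle[of x "c s" "c 0"]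
      by (simp add: dist_commute)
    then show ?thesis using False K_pos by linarith
  qed
qed

end

section \<open>Translation lengths in CAT(0) spaces\<close>

text \<open>Two vertices are placed at 0 and \<open>a\<close>; the law of cosines gives the real
  part \<open>u\<close> of the third.\<close>

lemma comparison_triangle_exists:
  fixes a b c :: real
  assumes "0 \<le> a" "0 \<le> b" "0 \<le> c" "a \<le> b + c" "b \<le> a + c" "c \<le> a + b"
  shows "\<exists>x y z :: complex. dist x y = a \<and> dist y z = b \<and> dist z x = c"
proof (cases "a = 0")
  case True
  then have "b = c" using assms by simp
  with True assms show ?thesis
    by (intro exI[of _ 0] exI[of _ 0] exI[of _ "of_real c"]) (simp add: dist_norm)
next
  case False
  then have a: "a > 0" using assms(1) by simp
  define u where "u = (a\<^sup>2 + c\<^sup>2 - b\<^sup>2) / (2 * a)"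
  have u: "2 * a * u = a\<^sup>2 + c\<^sup>2 - b\<^sup>2" using a by (simp add: u_def)
  have "(2 * a)\<^sup>2 * u\<^sup>2 = (2 * a * u)\<^sup>2" by (simp add: power_mult_distrib)
  also have "\<dots> = (a\<^sup>2 + c\<^sup>2 - b\<^sup>2)\<^sup>2" by (simp only: u)
  \<comment> \<open>Heron's factorisation: by the triangle inequalities the subtracted product is
    nonnegative.\<close>
  also have "\<dots> = (2 * a)\<^sup>2 * c\<^sup>2 - ((a + b + c) * (a + c - b)) * ((b + c - a) * (a + b - c))"
    by (simp add: power2_eq_square algebra_simps)
  also have "\<dots> \<le> (2 * a)\<^sup>2 * c\<^sup>2" using assms by simp
  finally have uc: "u\<^sup>2 \<le> c\<^sup>2" using a by simp
  define v where "v = sqrt (c\<^sup>2 - u\<^sup>2)"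
  have v: "v\<^sup>2 = c\<^sup>2 - u\<^sup>2" using uc by (simp add: v_def)
  have "dist (0::complex) (of_real a) = a" using a by (simp add: dist_norm)
  moreover have "dist (of_real a) (Complex u v) = b"
  proof -
    have "(a - u)\<^sup>2 + v\<^sup>2 = b\<^sup>2" using u v by (simp add: power2_eq_square algebra_simps)
    then show ?thesis using assms(2) by (simp add: dist_norm cmod_def)
  qed
  moreover have "dist (Complex u v) 0 = c"
    using v assms(3) by (simp add: dist_norm cmod_def)
  ultimately show ?thesis by blast
qed

text \<open>In the comparison triangle the segment joining the midpoints of two sides is half as
  long as the third side.\<close>

lemma CAT0_midpoints:
  fixes x1 :: "'a::metric_space"
  assumes "CAT0 TYPE('a)" and c12: "geodesic_segment c12 x1 x2" and c23: "geodesic_segment c23 x2 x3"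
  shows "dist (c12 (dist x1 x2 / 2)) (c23 (dist x2 x3 / 2)) \<le> dist x1 x3 / 2"
proof -
  obtain c31 where c31: "geodesic_segment c31 x3 x1"
    using assms(1) unfolding CAT0_def geodesic_space_def by blast
  obtain y1 y2 y3 :: complex where y: "dist y1 y2 = dist x1 x2" "dist y2 y3 = dist x2 x3" "dist y3 y1 = dist x3 x1"
    using comparison_triangle_exists[of "dist x1 x2" "dist x2 x3" "dist x3 x1"]
      dist_triangle[of x1 x2 x3] dist_triangle[of x2 x3 x1] dist_triangle[of x1 x3 x2]
    by (auto simp: dist_commute add.commute)
  let ?S = "{(c12, x1, x2, y1, y2), (c23, x2, x3, y2, y3), (c31, x3, x1, y3, y1)}"
  have "\<forall>(c, a, b, a', b')\<in>?S. \<forall>(e, p, q, p', q')\<in>?S. \<forall>s\<in>{0..dist a b}. \<forall>t\<in>{0..dist p q}.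
            dist (c s) (e t) \<le> dist (comparison_point a' b' (dist a b) s)
                                     (comparison_point p' q' (dist p q) t)"
    using assms(1)[unfolded CAT0_def Let_def, THEN conjunct2, THEN spec[of _ x1], THEN spec[of _ x2],
        THEN spec[of _ x3], THEN spec[of _ c12], THEN spec[of _ c23], THEN spec[of _ c31],
        THEN spec[of _ y1], THEN spec[of _ y2], THEN spec[of _ y3]] c12 c23 c31 y by (rule_tac mp) simp_all
  then have "dist (c12 (dist x1 x2 / 2)) (c23 (dist x2 x3 / 2)) \<le>
      dist (comparison_point y1 y2 (dist x1 x2) (dist x1 x2 / 2))
           (comparison_point y2 y3 (dist x2 x3) (dist x2 x3 / 2))"
    by simp
  also have "\<dots> = dist ((y1 + y2) / 2) ((y2 + y3) / 2)"
  proof -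
    have "comparison_point p q (dist p q) (dist p q / 2) = (p + q) / 2" for p q :: complex
      by (cases "p = q") (simp_all add: comparison_point_def field_simps)
    from this[of y1 y2] this[of y2 y3] show ?thesis by (simp only: y)
  qed
  also have "\<dots> = dist x1 x3 / 2"
  proof -
    have "(y1 + y2) / 2 - (y2 + y3) / 2 = (y1 - y3) / 2" by (simp add: field_simps)
    then have "dist ((y1 + y2) / 2) ((y2 + y3) / 2) = dist y1 y3 / 2"
      by (metis dist_norm norm_divide norm_numeral)
    then show ?thesis using y(3) by (simp add: dist_commute)
  qed
  finally show ?thesis .
qed

lemma transl_len_le: "transl_len g \<le> dist x (g x)"
  unfolding transl_len_def by (rule cINF_lower) (auto intro: bdd_belowI2[of _ 0])

lemma transl_len_greatest: "(\<And>x. b \<le> dist x (g x)) \<Longrightarrow> b \<le> transl_len g"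
  unfolding transl_len_def by (rule cINF_greatest) auto

lemma isometry_dist: "isometry g \<Longrightarrow> dist (g x) (g y) = dist x y"
  by (simp add: isometry_def)

lemma isometry_funpow:
  assumes "isometry g"
  shows "isometry (g ^^ n)"
proof (induction n)
  case 0
  show ?case by (simp add: isometry_def bij_def)
next
  case (Suc n)
  then show ?case using assms bij_comp[of "g ^^ n" g] by (simp add: isometry_def comp_def)
qed

text \<open>\<open>g\<close> maps the midpoint of a geodesic from \<open>x\<close> to
  \<open>g x\<close> to the midpoint of its image, so \<open>CAT0_midpoints\<close> bounds the
  displacement of the midpoint by half of that of \<open>x\<close> under the square.\<close>

lemma transl_len_square:
  fixes g :: "'a::metric_space \<Rightarrow> 'a"
  assumes "CAT0 TYPE('a)" "isometry g"
  shows "2 * transl_len g \<le> transl_len (g \<circ> g)"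
proof (rule transl_len_greatest)
  fix x
  obtain c where c: "geodesic_segment c x (g x)"
    using assms(1) unfolding CAT0_def geodesic_space_def by blast
  have gc: "geodesic_segment (g \<circ> c) (g x) (g (g x))"
    using c by (auto simp: geodesic_segment_def isometry_dist[OF assms(2)])
  let ?m = "c (dist x (g x) / 2)"
  have "transl_len g \<le> dist ?m (g ?m)" by (rule transl_len_le)
  also have "\<dots> \<le> dist x (g (g x)) / 2"
    using CAT0_midpoints[OF assms(1) c gc] by (simp add: isometry_dist[OF assms(2)])
  finally show "2 * transl_len g \<le> dist x ((g \<circ> g) x)" by simp
qed

lemma transl_len_power2:
  fixes g :: "'a::metric_space \<Rightarrow> 'a"
  assumes "CAT0 TYPE('a)" "isometry g"
  shows "2 ^ k * transl_len g \<le> transl_len (g ^^ (2 ^ k))"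
proof (induction k)
  case (Suc k)
  have "2 ^ Suc k * transl_len g \<le> 2 * transl_len (g ^^ (2 ^ k))" using Suc by simp
  also have "\<dots> \<le> transl_len (g ^^ (2 ^ k) \<circ> g ^^ (2 ^ k))"
    by (rule transl_len_square[OF assms(1) isometry_funpow[OF assms(2)]])
  also have "g ^^ (2 ^ k) \<circ> g ^^ (2 ^ k) = g ^^ (2 ^ Suc k)"
    by (simp add: funpow_add[symmetric] mult_2)
  finally show ?case .
qed simp

lemma dist_funpow_le:
  assumes "isometry g"
  shows "dist y ((g ^^ n) y) \<le> n * dist y (g y)"
proof (induction n)
  case (Suc n)
  have "dist ((g ^^ n) y) ((g ^^ n) (g y)) = dist y (g y)"
    by (rule isometry_dist[OF isometry_funpow[OF assms]])
  then show ?case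
    using Suc dist_triangle[of y "(g ^^ Suc n) y" "(g ^^ n) y"] by (simp add: funpow_swap1 algebra_simps)
qed simp

text \<open>The lower bound is \<open>transl_len_power2\<close>. For the upper bound,
  \<open>y\<close> nearly attains the infimum, and passing from \<open>y\<close> to \<open>x\<close>
  costs at most \<open>2 * dist x y\<close>, which vanishes after division by
  \<open>2 ^ k\<close>.\<close>

lemma transl_len_LIMSEQ:
  fixes g :: "'a::metric_space \<Rightarrow> 'a"
  assumes "CAT0 TYPE('a)" "isometry g"
  shows "(\<lambda>k. dist x ((g ^^ (2 ^ k)) x) / 2 ^ k) \<longlonglongrightarrow> transl_len g"
proof (rule order_tendstoI)
  fix b assume b: "b < transl_len g"
  have "b < dist x ((g ^^ (2 ^ k)) x) / 2 ^ k" for k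
  proof -
    have "2 ^ k * transl_len g \<le> dist x ((g ^^ (2 ^ k)) x)"
      using transl_len_power2[OF assms, of k] transl_len_le[of "g ^^ (2 ^ k)" x] by linarith
    then have "transl_len g \<le> dist x ((g ^^ (2 ^ k)) x) / 2 ^ k"
      by (simp add: field_simps)
    with b show ?thesis by linarith
  qed
  then show "\<forall>\<^sub>F k in sequentially. b < dist x ((g ^^ (2 ^ k)) x) / 2 ^ k" by simp
next
  fix b assume "transl_len g < b"
  then obtain y where y: "dist y (g y) < b"
    unfolding transl_len_def by (subst (asm) cINF_less_iff) (auto intro: bdd_belowI2[of _ 0])
  have up: "dist x ((g ^^ (2 ^ k)) x) / 2 ^ k \<le> dist y (g y) + 2 * dist x y * (1 / 2) ^ k" for k
  proof -
    let ?h = "g ^^ (2 ^ k)"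
    have "dist x (?h x) \<le> dist x y + dist y (?h y) + dist (?h y) (?h x)"
      using dist_triangle[of x "?h x" y] dist_triangle[of y "?h x" "?h y"] by linarith
    also have "\<dots> \<le> 2 ^ k * dist y (g y) + 2 * dist x y"
      using dist_funpow_le[OF assms(2), of y "2 ^ k"]
      by (simp add: isometry_dist[OF isometry_funpow[OF assms(2)]] dist_commute)
    finally show ?thesis by (simp add: field_simps)
  qed
  have "(\<lambda>k. dist y (g y) + 2 * dist x y * (1 / 2) ^ k) \<longlonglongrightarrow> dist y (g y) + 2 * dist x y * 0"
    by (intro tendsto_intros LIMSEQ_power_zero) simp
  then have "\<forall>\<^sub>F k in sequentially. dist y (g y) + 2 * dist x y * (1 / 2) ^ k < b"
    using y by (intro order_tendstoD(2)) auto
  then show "\<forall>\<^sub>F k in sequentially. dist x ((g ^^ (2 ^ k)) x) / 2 ^ k < b"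
    by eventually_elim (use up in \<open>blast intro: le_less_trans\<close>)
qed

section \<open>Axes and product geodesics\<close>

text \<open>On parameters \<open>g\<close> acts as an isometry \<open>u\<close> of the real line
  that moves every point by the same positive amount. This excludes a reflection.\<close>

lemma axis_translation:
  assumes g: "isometry g" and "is_axis g c" "\<forall>x. g x \<noteq> x"
  shows "transl_len g > 0" and "(\<forall>t. g (c t) = c (t + transl_len g)) \<or> (\<forall>t. g (c t) = c (t - transl_len g))"
proof -
  let ?l = "transl_len g"
  have line: "geodesic_line c" and inv: "g ` range c = range c" and tl: "\<And>t. dist (c t) (g (c t)) = ?l"
    using assms(2) by (auto simp: is_axis_def)
  show pos: "?l > 0" using tl[of 0] assms(3) by (metis zero_less_dist_iff)
  have "\<exists>u. g (c t) = c u" for t using inv by blast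
  then obtain u where u: "\<And>t. g (c t) = c (u t)" by metis
  have disp: "\<bar>t - u t\<bar> = ?l" for t
    using tl[of t] by (simp add: u geodesic_lineD[OF line])
  have iso: "\<bar>u s - u t\<bar> = \<bar>s - t\<bar>" for s t
    using isometry_dist[OF g, of "c s" "c t"] by (simp add: u geodesic_lineD[OF line])
  have mixed: "t = s + ?l" if "u s = s + ?l" "u t = t - ?l" for s t
    using iso[of s t] that pos by linarith
  have sgn: "u t = t + ?l \<or> u t = t - ?l" for t using disp[of t] by linarith
  show "(\<forall>t. g (c t) = c (t + ?l)) \<or> (\<forall>t. g (c t) = c (t - ?l))"
  proof (rule ccontr)
    assume "\<not> ?thesis"
    then obtain s t where st: "u s = s + ?l" "u t = t - ?l" using sgn u by metis
    then have "t = s + ?l" by (rule mixed)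
    \<comment> \<open>Opposite directions can only occur at parameters exactly \<open>?l\<close>
      apart, so the parameter halfway between \<open>s\<close> and \<open>t\<close> can move in
      neither.\<close>
    moreover have "u (s + ?l / 2) = s + ?l / 2 + ?l \<or> u (s + ?l / 2) = s + ?l / 2 - ?l" by (rule sgn)
    ultimately show False using mixed[OF _ st(2), of "s + ?l / 2"] mixed[OF st(1), of "s + ?l / 2"] pos by auto
  qed
qed

lemma contracting_line_mono:
  assumes "contracting_line c K" "K \<le> K'"
  shows "contracting_line c K'"
proof -
  interpret contracting_line c K by fact
  show ?thesis
    by unfold_locales (use line K_pos assms(2) in \<open>auto intro: order_trans[OF contraction]\<close>)
qed

text \<open>The axis is reversed if necessary, so that \<open>g\<close> moves it forwards. Both axes
  of \<alpha> thus get matching orientations.\<close>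

lemma rank_one_contracting_line:
  assumes "isometry g" "rank_one g"
  obtains c K l where "contracting_line c K" "l > 0" "\<And>t. g (c t) = c (t + l)"
proof -
  obtain c K where c: "is_axis g c" and "K > 0" and
    K: "\<And>x r p q. ball x r \<inter> range c = {} \<Longrightarrow> p \<in> nearest_proj (range c) (ball x r) \<Longrightarrow>
        q \<in> nearest_proj (range c) (ball x r) \<Longrightarrow> dist p q \<le> K"
    using assms(2) unfolding rank_one_def by blast
  have cl: "contracting_line c K"
    using c \<open>K > 0\<close> K by unfold_locales (auto simp: is_axis_def)
  have fp: "\<forall>x. g x \<noteq> x" using assms(2) by (auto simp: rank_one_def hyperbolic_def)
  note ax = axis_translation[OF assms(1) c fp]
  from ax(2) show thesis
  proof
    assume "\<forall>t. g (c t) = c (t + transl_len g)"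
    with cl ax(1) show thesis using that by blast
  next
    assume "\<forall>t. g (c t) = c (t - transl_len g)"
    then have "g (c (- t)) = c (- (t + transl_len g))" for t by simp
    with contracting_line.reverse[OF cl] ax(1) show thesis using that[of "\<lambda>t. c (- t)"] by blast
  qed
qed

text \<open>Two geodesics run at constant speeds over the same time form a geodesic of the product
  metric; the parameter \<open>u\<close> is the fraction covered.\<close>

lemma convex_product_geodesic:
  fixes x y :: "'a::metric_space \<times> 'b::metric_space"
  assumes "geod_convex C" "x \<in> C" "y \<in> C"
    and \<gamma>1: "geodesic_segment \<gamma>1 (fst x) (fst y)" and \<gamma>2: "geodesic_segment \<gamma>2 (snd x) (snd y)"
    and u: "0 \<le> u" "u \<le> 1"
  shows "(\<gamma>1 (u * dist (fst x) (fst y)), \<gamma>2 (u * dist (snd x) (snd y))) \<in> C"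
proof -
  let ?L1 = "dist (fst x) (fst y)" and ?L2 = "dist (snd x) (snd y)" and ?L = "dist x y"
  have L: "?L = sqrt (?L1\<^sup>2 + ?L2\<^sup>2)" by (simp add: dist_prod_def)
  show ?thesis
  proof (cases "?L = 0")
    case True
    then have "x = y" by simp
    then show ?thesis using \<gamma>1 \<gamma>2 assms(2) by (simp add: geodesic_segment_def)
  next
    case False
    then have L0: "?L > 0" using zero_le_dist[of x y] by linarith
    define \<gamma> where "\<gamma> s = (\<gamma>1 (s / ?L * ?L1), \<gamma>2 (s / ?L * ?L2))" for s
    have "geodesic_segment \<gamma> x y"
      unfolding geodesic_segment_def
    proof (intro conjI ballI)
      fix s t assume s: "s \<in> {0..?L}" and t: "t \<in> {0..?L}"
      have in_range: "r / ?L * M \<in> {0..M}" if "r \<in> {0..?L}" "0 \<le> M" for r M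
        using that L0 by (auto intro!: mult_left_le_one_le simp del: times_divide_eq_left)
      have d1: "dist (\<gamma>1 (s / ?L * ?L1)) (\<gamma>1 (t / ?L * ?L1)) = \<bar>s / ?L * ?L1 - t / ?L * ?L1\<bar>"
        using \<gamma>1 in_range[OF s, of ?L1] in_range[OF t, of ?L1] by (auto simp: geodesic_segment_def)
      have d2: "dist (\<gamma>2 (s / ?L * ?L2)) (\<gamma>2 (t / ?L * ?L2)) = \<bar>s / ?L * ?L2 - t / ?L * ?L2\<bar>"
        using \<gamma>2 in_range[OF s, of ?L2] in_range[OF t, of ?L2] by (auto simp: geodesic_segment_def)
      have "(dist (\<gamma> s) (\<gamma> t))\<^sup>2 = (s / ?L * ?L1 - t / ?L * ?L1)\<^sup>2 + (s / ?L * ?L2 - t / ?L * ?L2)\<^sup>2"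
        by (simp add: \<gamma>_def dist_Pair_Pair d1 d2 del: times_divide_eq_left)
      also have "\<dots> = ((s - t) / ?L)\<^sup>2 * (?L1\<^sup>2 + ?L2\<^sup>2)"
      proof -
        have "s / ?L * M - t / ?L * M = (s - t) / ?L * M" for M
          by (simp add: left_diff_distrib diff_divide_distrib)
        then show ?thesis by (simp only: power_mult_distrib distrib_left)
      qed
      also have "?L1\<^sup>2 + ?L2\<^sup>2 = ?L\<^sup>2" by (simp add: L)
      also have "((s - t) / ?L)\<^sup>2 * ?L\<^sup>2 = \<bar>s - t\<bar>\<^sup>2"
        using L0 by (simp add: power_divide)
      finally show "dist (\<gamma> s) (\<gamma> t) = \<bar>s - t\<bar>"
        using power2_eq_imp_eq[of "dist (\<gamma> s) (\<gamma> t)" "\<bar>s - t\<bar>"] by simp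
    qed (use L0 \<gamma>1 \<gamma>2 in \<open>auto simp: \<gamma>_def geodesic_segment_def\<close>)
    then have "\<gamma> ` {0..?L} \<subseteq> C"
      using assms(1-3) unfolding geod_convex_def by blast
    moreover have "u * ?L \<in> {0..?L}" using u by (simp add: mult_left_le_one_le)
    ultimately have "\<gamma> (u * ?L) \<in> C" by blast
    then show ?thesis using L0 by (simp add: \<gamma>_def)
  qed
qed

section \<open>Slopes in the convex set\<close>

text \<open>Assumption \<open>coupled\<close> is what cocompactness together with proper discontinuity on the
  second factor provides.\<close>
locale coupled_lines =
  fixes C :: "('a::metric_space \<times> 'b::metric_space) set" and x1 x2 c1 c2 K D l1 l2
  assumes geodesics1: "geodesic_space TYPE('a)" and geodesics2: "geodesic_space TYPE('b)"
    and convex: "geod_convex C" and base: "(x1, x2) \<in> C"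
    and contracting1: "contracting_line c1 K" and contracting2: "contracting_line c2 K"
    and near1: "dist x1 (c1 0) \<le> D" and near2: "dist x2 (c2 0) \<le> D"
    and l1_pos: "l1 > 0" and l2_pos: "l2 > 0"
    and shift: "\<And>n::int. \<exists>g1 g2. isometry g1 \<and> isometry g2 \<and> (\<forall>t. g1 (c1 t) = c1 (t + n * l1)) \<and>
      (\<forall>t. g2 (c2 t) = c2 (t + n * l2)) \<and> (\<forall>z\<in>C. (g1 (fst z), g2 (snd z)) \<in> C)"
    and coupled: "\<And>E. \<exists>B. \<forall>z\<in>C. \<forall>t1 t2. dist (fst z) (c1 t1) \<le> E \<longrightarrow> dist (snd z) (c2 t2) \<le> E \<longrightarrow>
      \<bar>t1 - l1 / l2 * t2\<bar> \<le> B"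
begin

text \<open>Both lines are reversed together: the two parameters in \<open>coupled\<close> change
  sign at once, and the shift by \<open>n\<close> becomes the shift by \<open>- n\<close>.\<close>

lemma reverse: "coupled_lines C x1 x2 (\<lambda>t. c1 (- t)) (\<lambda>t. c2 (- t)) K D l1 l2"
proof (rule coupled_lines.intro)
  fix n :: int
  obtain g1 g2 where g: "isometry g1" "isometry g2" "\<And>t. g1 (c1 t) = c1 (t + of_int (- n) * l1)"
    "\<And>t. g2 (c2 t) = c2 (t + of_int (- n) * l2)" "\<forall>z\<in>C. (g1 (fst z), g2 (snd z)) \<in> C"
    using shift[of "- n"] by blast
  show "\<exists>g1 g2. isometry g1 \<and> isometry g2 \<and> (\<forall>t. g1 (c1 (- t)) = c1 (- (t + n * l1))) \<and>
      (\<forall>t. g2 (c2 (- t)) = c2 (- (t + n * l2))) \<and> (\<forall>z\<in>C. (g1 (fst z), g2 (snd z)) \<in> C)"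
    using g by (intro exI[of _ g1] exI[of _ g2]) simp
next
  fix E
  obtain B where B: "\<And>z t1 t2. z \<in> C \<Longrightarrow> dist (fst z) (c1 t1) \<le> E \<Longrightarrow> dist (snd z) (c2 t2) \<le> E \<Longrightarrow>
      \<bar>t1 - l1 / l2 * t2\<bar> \<le> B"
    using coupled[of E] by blast
  have "\<bar>t1 - l1 / l2 * t2\<bar> \<le> B" if "z \<in> C" "dist (fst z) (c1 (- t1)) \<le> E" "dist (snd z) (c2 (- t2)) \<le> E"
    for z t1 t2
    using B[OF that] by (simp add: abs_minus_commute)
  then show "\<exists>B. \<forall>z\<in>C. \<forall>t1 t2. dist (fst z) (c1 (- t1)) \<le> E \<longrightarrow> dist (snd z) (c2 (- t2)) \<le> E \<longrightarrow>
      \<bar>t1 - l1 / l2 * t2\<bar> \<le> B" by blast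
qed (use geodesics1 geodesics2 convex base contracting1 contracting2 near1 near2 l1_pos l2_pos
    in \<open>auto intro: contracting_line.reverse\<close>)

text \<open>The point lies at the fraction \<open>T / m\<close> of a product geodesic in
  \<open>C\<close>. As \<open>m\<close> is the larger distance, both factors have run for at most
  \<open>T\<close>, one of them for exactly \<open>T\<close>. The lines \<open>d1\<close> and
  \<open>d2\<close> are free so that a single one of \<open>c1\<close> and \<open>c2\<close> can be
  reversed.\<close>

lemma geodesic_point:
  assumes z: "z \<in> C" and d1: "contracting_line d1 K" "dist x1 (d1 0) \<le> D" "foot d1 (fst z) q1"
    and d2: "contracting_line d2 K" "dist x2 (d2 0) \<le> D" "foot d2 (snd z) q2"
    and T: "0 < T" "T \<le> q1 - 12 * K - 3 * D" "T \<le> q2 - 12 * K - 3 * D"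
  defines "m \<equiv> max (dist x1 (fst z)) (dist x2 (snd z))"
  obtains p where "p \<in> C" "T \<le> m"
    "dist (fst p) (d1 (T / m * dist x1 (fst z))) \<le> 14 * K + 5 * D"
    "dist (snd p) (d2 (T / m * dist x2 (snd z))) \<le> 14 * K + 5 * D"
proof -
  interpret d1: contracting_line d1 K by fact
  interpret d2: contracting_line d2 K by fact
  obtain \<gamma>1 \<gamma>2 where \<gamma>1: "geodesic_segment \<gamma>1 x1 (fst z)" and \<gamma>2: "geodesic_segment \<gamma>2 x2 (snd z)"
    using geodesics1 geodesics2 unfolding geodesic_space_def by metis
  have Tm: "T \<le> m"
    using d1.fellow_travel(1)[OF \<gamma>1 d1(2,3), of T] T by (simp add: m_def)
  have u: "0 \<le> T / m" "T / m \<le> 1" using T Tm by auto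
  have le: "T / m * L \<le> T" if "L \<le> m" for L
    using that T Tm by (simp add: field_simps)
  have nn: "0 \<le> T / m * dist x y" for x y :: "'c::metric_space"
    using u(1) by (rule mult_nonneg_nonneg) simp
  have "dist (\<gamma>1 (T / m * dist x1 (fst z))) (d1 (T / m * dist x1 (fst z))) \<le> 14 * K + 5 * D"
    by (rule d1.fellow_travel(2)[OF \<gamma>1 d1(2,3) nn order_trans[OF le T(2)]]) (simp add: m_def)
  moreover have "dist (\<gamma>2 (T / m * dist x2 (snd z))) (d2 (T / m * dist x2 (snd z))) \<le> 14 * K + 5 * D"
    by (rule d2.fellow_travel(2)[OF \<gamma>2 d2(2,3) nn order_trans[OF le T(3)]]) (simp add: m_def)
  moreover have "(\<gamma>1 (T / m * dist x1 (fst z)), \<gamma>2 (T / m * dist x2 (snd z))) \<in> C"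
    using convex_product_geodesic[OF convex base z, of \<gamma>1 \<gamma>2 "T / m"] \<gamma>1 \<gamma>2 u by simp
  ultimately show thesis using that Tm by force
qed

text \<open>With only the second line reversed, \<open>geodesic_point\<close> yields a point of
  \<open>C\<close> near \<open>c1 t1\<close> and \<open>c2 (- t2)\<close> with \<open>t1\<close> and
  \<open>t2\<close> nonnegative and one of them equal to \<open>T\<close>. For large
  \<open>T\<close> this violates \<open>coupled\<close>.\<close>

lemma no_opposite_feet:
  "\<exists>M. \<forall>z\<in>C. \<forall>q1 q2. foot c1 (fst z) q1 \<longrightarrow> foot c2 (snd z) q2 \<longrightarrow> q1 \<le> M \<or> - M \<le> q2"
proof -
  obtain B where B: "\<And>z t1 t2. z \<in> C \<Longrightarrow> dist (fst z) (c1 t1) \<le> 14 * K + 5 * D \<Longrightarrow>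
      dist (snd z) (c2 t2) \<le> 14 * K + 5 * D \<Longrightarrow> \<bar>t1 - l1 / l2 * t2\<bar> \<le> B"
    using coupled[of "14 * K + 5 * D"] by blast
  define a where "a = l1 / l2"
  have a: "a > 0" using l1_pos l2_pos by (simp add: a_def)
  define T where "T = \<bar>B\<bar> + \<bar>B\<bar> / a + 1"
  have T: "T > 0" "T > B" "a * T > B"
  proof -
    have "\<bar>B\<bar> / a \<ge> 0" using a by simp
    then show "T > 0" "T > B" unfolding T_def by linarith+
    have "a * T = a * (\<bar>B\<bar> + 1) + \<bar>B\<bar>" using a by (simp add: T_def algebra_simps)
    moreover have "a * (\<bar>B\<bar> + 1) > 0" using a by simp
    ultimately show "a * T > B" by linarith
  qed
  have "q1 \<le> T + 12 * K + 3 * D \<or> - (T + 12 * K + 3 * D) \<le> q2"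
    if z: "z \<in> C" and q: "foot c1 (fst z) q1" "foot c2 (snd z) q2" for z q1 q2
  proof (rule ccontr)
    assume "\<not> ?thesis"
    then have le: "T \<le> q1 - 12 * K - 3 * D" "T \<le> - q2 - 12 * K - 3 * D" by linarith+
    let ?L1 = "dist x1 (fst z)" and ?L2 = "dist x2 (snd z)"
    define m where "m = max ?L1 ?L2"
    have "foot (\<lambda>t. c2 (- t)) (snd z) (- q2)" using q(2) by (simp add: foot_reverse)
    then obtain p where p: "p \<in> C" "T \<le> m" "dist (fst p) (c1 (T / m * ?L1)) \<le> 14 * K + 5 * D"
      "dist (snd p) (c2 (- (T / m * ?L2))) \<le> 14 * K + 5 * D"
      using geodesic_point[OF z contracting1 near1 q(1) contracting_line.reverse[OF contracting2] _ _ T(1) le]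
        near2 unfolding m_def by auto
    have nn: "0 \<le> T / m * ?L1" "0 \<le> a * (T / m * ?L2)" using T(1) p(2) a by simp_all
    have "\<bar>T / m * ?L1 - a * (- (T / m * ?L2))\<bar> \<le> B"
      unfolding a_def by (rule B[OF p(1,3,4)])
    then have "T / m * ?L1 + a * (T / m * ?L2) \<le> B" using nn by linarith
    then have "T / m * ?L1 \<le> B" "a * (T / m * ?L2) \<le> B" using nn by linarith+
    moreover have "T / m * ?L1 = T \<or> T / m * ?L2 = T"
      using T(1) p(2) by (auto simp: m_def max_def split: if_splits)
    ultimately show False using T(2,3) by (metis not_less)
  qed
  then show ?thesis by blast
qed

text \<open>A high power of the translations moves \<open>z\<close> so that the geodesic from the base point follows
  both lines for a long time, which forces its slope to be close to \<open>l1 / l2\<close>; the move itself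
  changes the two distances only by a constant.\<close>
lemma slope_of_forward_points:
  assumes "\<epsilon> > 0"
  shows "\<exists>N. \<forall>z\<in>C. \<forall>q1 q2. foot c1 (fst z) q1 \<longrightarrow> foot c2 (snd z) q2 \<longrightarrow> - M \<le> q1 \<longrightarrow> - M \<le> q2 \<longrightarrow>
    \<bar>dist x1 (fst z) - l1 / l2 * dist x2 (snd z)\<bar> \<le> \<epsilon> * (dist x1 (fst z) + dist x2 (snd z)) + N"
proof -
  obtain B where B: "\<And>z t1 t2. z \<in> C \<Longrightarrow> dist (fst z) (c1 t1) \<le> 14 * K + 5 * D \<Longrightarrow>
      dist (snd z) (c2 t2) \<le> 14 * K + 5 * D \<Longrightarrow> \<bar>t1 - l1 / l2 * t2\<bar> \<le> B"
    using coupled[of "14 * K + 5 * D"] by blast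
  define a where "a = l1 / l2"
  have a: "a > 0" using l1_pos l2_pos by (simp add: a_def)
  \<comment> \<open>Following the lines for time \<open>T\<close> turns the additive error
    \<open>B\<close> into a relative error of at most \<epsilon>.\<close>
  define T where "T = \<bar>B\<bar> / \<epsilon> + 1"
  have T: "T > 0" "B \<le> \<epsilon> * T"
  proof -
    have "\<bar>B\<bar> / \<epsilon> \<ge> 0" using assms by simp
    then show "T > 0" unfolding T_def by linarith
    have "\<epsilon> * T = \<bar>B\<bar> + \<epsilon>" using assms by (simp add: T_def distrib_left)
    then show "B \<le> \<epsilon> * T" using assms by linarith
  qed
  \<comment> \<open>A shift by \<open>Q\<close> takes feet that are at least \<open>- M\<close> to
    where \<open>geodesic_point\<close> can be used with \<open>T\<close>.\<close>
  define Q where "Q = T + M + 12 * K + 3 * D"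
  obtain n :: nat where n: "Q \<le> n * l1" "Q \<le> n * l2"
  proof -
    obtain n where "Q / min l1 l2 \<le> real n" using real_arch_simple by blast
    then have "Q \<le> n * min l1 l2" using l1_pos l2_pos by (simp add: pos_divide_le_eq)
    then have "Q \<le> n * l1" "Q \<le> n * l2"
      by (meson min.cobounded1 min.cobounded2 mult_left_mono of_nat_0_le_iff order_trans)+
    then show thesis by (rule that)
  qed
  obtain g1 g2 where g1: "isometry g1" "\<And>t. g1 (c1 t) = c1 (t + n * l1)"
    and g2: "isometry g2" "\<And>t. g2 (c2 t) = c2 (t + n * l2)" and gC: "\<forall>z\<in>C. (g1 (fst z), g2 (snd z)) \<in> C"
    using shift[of "int n"] by auto
  have moved: "\<bar>dist x (g z) - dist x z\<bar> \<le> n * l + 2 * D"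
    if "isometry g" "\<And>t. g (c t) = c (t + n * l)" "geodesic_line c" "dist x (c 0) \<le> D" "0 < l"
    for x z and g :: "'c::metric_space \<Rightarrow> 'c" and c and l :: real
  proof -
    have "dist (g (c 0)) (c 0) = n * l"
      using that(2)[of 0] that(5) by (simp add: geodesic_lineD[OF that(3)])
    moreover have "dist (g x) (g (c 0)) = dist x (c 0)" "dist (g x) (g z) = dist x z"
      by (rule isometry_dist[OF that(1)])+
    moreover have "dist x (g x) \<le> dist x (c 0) + dist (g (c 0)) (c 0) + dist (g x) (g (c 0))"
      using dist_triangle[of x "g x" "c 0"] dist_triangle[of "c 0" "g x" "g (c 0)"] by (simp add: dist_commute)
    ultimately show ?thesis
      using that(4) dist_triangle[of x "g z" "g x"] dist_triangle[of "g x" "g z" x] by (simp add: dist_commute)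
  qed
  \<comment> \<open>\<open>N\<close> collects the cost of returning from the moved point to
    \<open>z\<close> on both sides of the inequality.\<close>
  define N where "N = (1 + \<epsilon>) * (n * l1 + 2 * D) + (a + \<epsilon>) * (n * l2 + 2 * D)"
  have "\<bar>dist x1 (fst z) - a * dist x2 (snd z)\<bar> \<le> \<epsilon> * (dist x1 (fst z) + dist x2 (snd z)) + N"
    if z: "z \<in> C" and q: "foot c1 (fst z) q1" "foot c2 (snd z) q2" "- M \<le> q1" "- M \<le> q2" for z q1 q2
  proof -
    let ?z = "(g1 (fst z), g2 (snd z))"
    define L1 L2 where "L1 = dist x1 (g1 (fst z))" and "L2 = dist x2 (g2 (snd z))"
    define m where "m = max L1 L2"
    have f: "foot c1 (fst ?z) (q1 + n * l1)" "foot c2 (snd ?z) (q2 + n * l2)"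
      using foot_translate[OF g1 q(1)] foot_translate[OF g2 q(2)] by simp_all
    have le: "T \<le> q1 + n * l1 - 12 * K - 3 * D" "T \<le> q2 + n * l2 - 12 * K - 3 * D"
      using n q(3,4) by (simp_all add: Q_def)
    have zC: "?z \<in> C" using gC z by blast
    obtain p where p: "p \<in> C" "T \<le> m" "dist (fst p) (c1 (T / m * L1)) \<le> 14 * K + 5 * D"
      "dist (snd p) (c2 (T / m * L2)) \<le> 14 * K + 5 * D"
      using geodesic_point[OF zC contracting1 near1 f(1) contracting2 near2 f(2) T(1) le]
      unfolding m_def L1_def L2_def by auto
    have "\<bar>T / m * L1 - a * (T / m * L2)\<bar> \<le> B" unfolding a_def by (rule B[OF p(1,3,4)])
    also have "T / m * L1 - a * (T / m * L2) = T / m * (L1 - a * L2)" by (simp add: algebra_simps)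
    finally have "T / m * \<bar>L1 - a * L2\<bar> \<le> B" using T(1) p(2) by (simp add: abs_mult)
    also have "\<dots> \<le> \<epsilon> * T" by (rule T)
    finally have "\<bar>L1 - a * L2\<bar> \<le> \<epsilon> * m" using T(1) p(2) by (simp add: field_simps)
    also have "\<dots> \<le> \<epsilon> * (L1 + L2)"
      using assms by (intro mult_left_mono) (auto simp: m_def L1_def L2_def)
    finally have main: "\<bar>L1 - a * L2\<bar> \<le> \<epsilon> * (L1 + L2)" .
    let ?M1 = "dist x1 (fst z)" and ?M2 = "dist x2 (snd z)"
    have m1: "\<bar>L1 - ?M1\<bar> \<le> n * l1 + 2 * D" and m2: "\<bar>L2 - ?M2\<bar> \<le> n * l2 + 2 * D"
      unfolding L1_def L2_def
      using moved[OF g1 contracting_line.line[OF contracting1] near1 l1_pos]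
        moved[OF g2 contracting_line.line[OF contracting2] near2 l2_pos] by blast+
    have "\<epsilon> * L1 \<le> \<epsilon> * (?M1 + (n * l1 + 2 * D))" "\<epsilon> * L2 \<le> \<epsilon> * (?M2 + (n * l2 + 2 * D))"
      using m1 m2 assms by (intro mult_left_mono; linarith)+
    moreover have "\<bar>a * L2 - a * ?M2\<bar> \<le> a * (n * l2 + 2 * D)"
      using m2 a by (simp add: abs_mult flip: right_diff_distrib)
    ultimately show ?thesis
      using main m1 unfolding N_def by (simp add: algebra_simps) 
  qed
  then show ?thesis unfolding a_def by blast
qed

text \<open>By \<open>no_opposite_feet\<close> in both orientations, the feet of a point are both at
  least \<open>- M\<close> or both at most \<open>M\<close>. The second case is the first one for
  the reversed lines.\<close>

lemma slope:
  assumes "\<epsilon> > 0"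
  shows "\<exists>N. \<forall>z\<in>C. \<bar>dist x1 (fst z) - l1 / l2 * dist x2 (snd z)\<bar> \<le>
    \<epsilon> * (dist x1 (fst z) + dist x2 (snd z)) + N"
proof -
  interpret rev: coupled_lines C x1 x2 "\<lambda>t. c1 (- t)" "\<lambda>t. c2 (- t)" K D l1 l2 by (rule reverse)
  obtain M1 where M1: "\<And>z q1 q2. z \<in> C \<Longrightarrow> foot c1 (fst z) q1 \<Longrightarrow> foot c2 (snd z) q2 \<Longrightarrow> q1 \<le> M1 \<or> - M1 \<le> q2"
    using no_opposite_feet by blast
  obtain M2 where "\<And>z q1 q2. z \<in> C \<Longrightarrow> foot c1 (fst z) (- q1) \<Longrightarrow> foot c2 (snd z) (- q2) \<Longrightarrow> q1 \<le> M2 \<or> - M2 \<le> q2"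
    using rev.no_opposite_feet unfolding foot_reverse by blast
  then have M2: "- q1 \<le> M2 \<or> - M2 \<le> - q2" if "z \<in> C" "foot c1 (fst z) q1" "foot c2 (snd z) q2" for z q1 q2
    using that by (metis minus_minus)
  define M where "M = max M1 M2"
  let ?P = "\<lambda>N z. \<bar>dist x1 (fst z) - l1 / l2 * dist x2 (snd z)\<bar> \<le> \<epsilon> * (dist x1 (fst z) + dist x2 (snd z)) + N"
  obtain N1 where N1: "\<And>z q1 q2. z \<in> C \<Longrightarrow> foot c1 (fst z) q1 \<Longrightarrow> foot c2 (snd z) q2 \<Longrightarrow>
      - M \<le> q1 \<Longrightarrow> - M \<le> q2 \<Longrightarrow> ?P N1 z"
    using slope_of_forward_points[OF assms, of M] by blast
  obtain N2 where N2: "\<And>z q1 q2. z \<in> C \<Longrightarrow> foot c1 (fst z) (- q1) \<Longrightarrow> foot c2 (snd z) (- q2) \<Longrightarrow>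
      - M \<le> q1 \<Longrightarrow> - M \<le> q2 \<Longrightarrow> ?P N2 z"
    using rev.slope_of_forward_points[OF assms, of M] unfolding foot_reverse by blast
  have "?P (max N1 N2) z" if z: "z \<in> C" for z
  proof -
    obtain q1 q2 where q: "foot c1 (fst z) q1" "foot c2 (snd z) q2"
      using foot_exists contracting_line.line contracting1 contracting2 by metis
    consider "- M \<le> q1" "- M \<le> q2" | "q1 \<le> M" "q2 \<le> M"
      using M1[OF z q] M2[OF z q] unfolding M_def by linarith
    then have "?P N1 z \<or> ?P N2 z"
      using N1[OF z q] N2[OF z, of "- q1" "- q2"] q by cases auto
    then show ?thesis by linarith
  qed
  then show ?thesis by blast
qed

end

section \<open>Group actions\<close>

text \<open>Write a point of \<open>C\<close> as a translate of a point of \<open>Q\<close> by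
  \<open>g\<close>. If its second coordinate is bounded, \<open>\<rho>2 g\<close> maps some point of
  a fixed compact ball into that ball, so only finitely many \<open>g\<close> occur, and these move
  \<open>x1\<close> by a bounded amount.\<close>

lemma fibre_bounded:
  fixes \<rho>1 :: "'g \<Rightarrow> 'a::metric_space \<Rightarrow> 'a" and \<rho>2 :: "'g \<Rightarrow> 'b::metric_space \<Rightarrow> 'b"
  assumes proper: "proper_space TYPE('b)" and "isom_action G \<rho>1" "isom_action G \<rho>2"
    and pd: "properly_discontinuous G \<rho>2"
    and Q: "compact Q" "C \<subseteq> (\<Union>g\<in>carrier G. diag_action \<rho>1 \<rho>2 g ` Q)"
  shows "\<exists>R'. \<forall>p\<in>C. dist (snd p) x2 \<le> R \<longrightarrow> dist (fst p) x1 \<le> R'"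
proof -
  have iso: "isometry (\<rho>1 g)" "isometry (\<rho>2 g)" if "g \<in> carrier G" for g
    using assms that by (auto simp: isom_action_def)
  obtain B where B: "\<And>q. q \<in> Q \<Longrightarrow> dist (x1, x2) q \<le> B"
    using compact_imp_bounded[OF Q(1)] bounded_any_center[of Q "(x1, x2)"] by blast
  have B1: "dist x1 (fst q) \<le> B" and B2: "dist x2 (snd q) \<le> B" if "q \<in> Q" for q
    using B[OF that] dist_fst_le[of "(x1, x2)" q] dist_snd_le[of "(x1, x2)" q] by simp_all
  define S where "S = {g\<in>carrier G. \<rho>2 g ` cball x2 (\<bar>B\<bar> + \<bar>R\<bar>) \<inter> cball x2 (\<bar>B\<bar> + \<bar>R\<bar>) \<noteq> {}}"
  have "finite S"
    using pd proper unfolding S_def properly_discontinuous_def proper_space_def by blast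
  then obtain A where A: "\<And>g. g \<in> S \<Longrightarrow> dist (\<rho>1 g x1) x1 \<le> A"
    using bdd_above_finite[of "(\<lambda>g. dist (\<rho>1 g x1) x1) ` S"] by (force simp: bdd_above_def)
  have "dist (fst p) x1 \<le> B + A" if p: "p \<in> C" "dist (snd p) x2 \<le> R" for p
  proof -
    obtain g q where g: "g \<in> carrier G" "q \<in> Q" "p = (\<rho>1 g (fst q), \<rho>2 g (snd q))"
      using Q(2) p(1) by (auto simp: diag_action_def)
    have "snd q \<in> cball x2 (\<bar>B\<bar> + \<bar>R\<bar>)" "\<rho>2 g (snd q) \<in> cball x2 (\<bar>B\<bar> + \<bar>R\<bar>)"
      using B2[OF g(2)] p(2) g(3) by (auto simp: dist_commute)
    then have "g \<in> S" using g(1) unfolding S_def by blast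
    then have "dist (\<rho>1 g x1) x1 \<le> A" by (rule A)
    moreover have "dist (fst p) (\<rho>1 g x1) \<le> B"
      using B1[OF g(2)] isometry_dist[OF iso(1)[OF g(1)], of "fst q" x1] g(3) by (simp add: dist_commute)
    ultimately show ?thesis using dist_triangle[of "fst p" x1 "\<rho>1 g x1"] by linarith
  qed
  then show ?thesis by blast
qed

lemma isom_action_inv_translation:
  assumes act: "isom_action G \<rho>" and g: "g \<in> carrier G" and c: "\<And>t::real. \<rho> g (c t) = c (t + l)"
  shows "\<rho> (inv\<^bsub>G\<^esub> g) (c t) = c (t - l)"
proof -
  interpret group G using act by (simp add: isom_action_def)
  have "\<rho> (inv\<^bsub>G\<^esub> g) \<circ> \<rho> g = id"
    using act g by (metis inv_closed l_inv isom_action_def)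
  then have "\<rho> (inv\<^bsub>G\<^esub> g) (\<rho> g (c (t - l))) = c (t - l)" by (simp add: fun_eq_iff)
  then show ?thesis by (simp add: c)
qed

text \<open>A power of \<open>g\<close>, possibly negative, serves both lines at once.\<close>

lemma isom_action_shift:
  assumes act1: "isom_action G \<rho>1" and act2: "isom_action G \<rho>2" and g: "g \<in> carrier G"
    and c1: "\<And>t::real. \<rho>1 g (c1 t) = c1 (t + l1)" and c2: "\<And>t::real. \<rho>2 g (c2 t) = c2 (t + l2)"
  shows "\<exists>h\<in>carrier G. (\<forall>t. \<rho>1 h (c1 t) = c1 (t + of_int n * l1)) \<and> (\<forall>t. \<rho>2 h (c2 t) = c2 (t + of_int n * l2))"
proof -
  interpret group G using act1 by (simp add: isom_action_def)
  have mult: "\<rho>1 (a \<otimes>\<^bsub>G\<^esub> b) y = \<rho>1 a (\<rho>1 b y)" "\<rho>2 (a \<otimes>\<^bsub>G\<^esub> b) z = \<rho>2 a (\<rho>2 b z)"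
    if "a \<in> carrier G" "b \<in> carrier G" for a b y z
    using act1 act2 that by (simp_all add: isom_action_def)
  define P where "P n h \<longleftrightarrow> h \<in> carrier G \<and> (\<forall>t. \<rho>1 h (c1 t) = c1 (t + of_int n * l1)) \<and>
    (\<forall>t. \<rho>2 h (c2 t) = c2 (t + of_int n * l2))" for n h
  have step: "P (i + j) (k \<otimes>\<^bsub>G\<^esub> h)" if "P i h" "P j k" for i j h k
    using that by (simp add: P_def mult distrib_right add.assoc)
  have "P 1 g" using g c1 c2 by (simp add: P_def)
  moreover have "P (- 1) (inv\<^bsub>G\<^esub> g)"
    using g isom_action_inv_translation[OF act1 g, of c1 l1, OF c1]
      isom_action_inv_translation[OF act2 g, of c2 l2, OF c2] by (simp add: P_def)
  moreover have "P 0 \<one>\<^bsub>G\<^esub>" using act1 act2 by (simp add: P_def isom_action_def)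
  ultimately have "\<exists>h. P n h"
    by (induction n rule: int_induct[where k = 0]) (use step[of _ _ 1] step[of _ _ "- 1"] in fastforce)+
  then show ?thesis unfolding P_def by blast
qed

lemma isom_action_pow:
  assumes "isom_action G \<rho>" "g \<in> carrier G"
  shows "\<rho> (g [^]\<^bsub>G\<^esub> (n::nat)) = \<rho> g ^^ n"
proof -
  interpret group G using assms(1) by (simp add: isom_action_def)
  show ?thesis
    using assms by (induction n) (simp_all add: isom_action_def funpow_swap1 fun_eq_iff)
qed

theorem theorem1p2:
  fixes G :: "('g, 'm) monoid_scheme"
    and \<rho>1 :: "'g \<Rightarrow> 'a::metric_space \<Rightarrow> 'a"
    and \<rho>2 :: "'g \<Rightarrow> 'b::metric_space \<Rightarrow> 'b"
    and \<alpha> :: 'g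
  assumes "proper_space TYPE('a)" and "CAT0 TYPE('a)"
    and "proper_space TYPE('b)" and "CAT0 TYPE('b)"
    and "group G"
    and "isom_action G \<rho>1" and "properly_discontinuous G \<rho>1"
    and "isom_action G \<rho>2" and "properly_discontinuous G \<rho>2"
    and "\<alpha> \<in> carrier G" and "rank_one (\<rho>1 \<alpha>)" and "rank_one (\<rho>2 \<alpha>)"
    and "convex_cocompact G (diag_action \<rho>1 \<rho>2)"
  shows "\<exists>lam>0. \<forall>\<gamma>\<in>carrier G. transl_len (\<rho>1 \<gamma>) = lam * transl_len (\<rho>2 \<gamma>)"
proof -
  interpret group G by fact
  have iso1: "isometry (\<rho>1 g)" and iso2: "isometry (\<rho>2 g)" if "g \<in> carrier G" for g
    using assms(6,8) that by (auto simp: isom_action_def)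
  obtain C Q where "C \<noteq> {}" and convex: "geod_convex C"
    and inv: "\<And>g z. g \<in> carrier G \<Longrightarrow> z \<in> C \<Longrightarrow> (\<rho>1 g (fst z), \<rho>2 g (snd z)) \<in> C"
    and Q: "compact Q" "C \<subseteq> (\<Union>g\<in>carrier G. diag_action \<rho>1 \<rho>2 g ` Q)"
    using assms(13) unfolding convex_cocompact_def by (auto simp: image_subset_iff diag_action_def)
  obtain x1 x2 where x: "(x1, x2) \<in> C" using \<open>C \<noteq> {}\<close> by auto
  obtain c1 K1 l1 where c1: "contracting_line c1 K1" "l1 > 0" "\<And>t. \<rho>1 \<alpha> (c1 t) = c1 (t + l1)"
    using rank_one_contracting_line[OF iso1[OF assms(10)] assms(11)] by blast
  obtain c2 K2 l2 where c2: "contracting_line c2 K2" "l2 > 0" "\<And>t. \<rho>2 \<alpha> (c2 t) = c2 (t + l2)"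
    using rank_one_contracting_line[OF iso2[OF assms(10)] assms(12)] by blast
  have line1: "geodesic_line c1" and line2: "geodesic_line c2"
    using c1(1) c2(1) by (simp_all add: contracting_line.line)
  define D where "D = max (dist x1 (c1 0)) (dist x2 (c2 0))"
  have D: "dist x1 (c1 0) \<le> D" "dist x2 (c2 0) \<le> D" by (simp_all add: D_def)
  note shift = isom_action_shift[OF assms(6,8,10), of c1 l1 c2 l2, OF c1(3) c2(3)]
  interpret coupled_lines C x1 x2 c1 c2 "max K1 K2" D l1 l2
  proof (rule coupled_lines.intro)
    fix n :: int
    show "\<exists>g1 g2. isometry g1 \<and> isometry g2 \<and> (\<forall>t. g1 (c1 t) = c1 (t + n * l1)) \<and>
      (\<forall>t. g2 (c2 t) = c2 (t + n * l2)) \<and> (\<forall>z\<in>C. (g1 (fst z), g2 (snd z)) \<in> C)"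
    proof -
      obtain h where "h \<in> carrier G" "\<And>t. \<rho>1 h (c1 t) = c1 (t + n * l1)" "\<And>t. \<rho>2 h (c2 t) = c2 (t + n * l2)"
        using shift[of n] by auto
      then show ?thesis
        using iso1 iso2 inv by (intro exI[of _ "\<rho>1 h"] exI[of _ "\<rho>2 h"]) simp
    qed
  next
    fix E
    \<comment> \<open>The radius adds the distance \<open>E\<close> to the second axis, the
      remainder \<open>l2\<close> after whole periods are removed, and the distance \<open>D\<close>
      from the base point to the axis.\<close>
    obtain R where R: "\<And>p. p \<in> C \<Longrightarrow> dist (snd p) x2 \<le> E + l2 + D \<Longrightarrow> dist (fst p) x1 \<le> R"
      using fibre_bounded[OF assms(3,6,8,9) Q] by blast
    have "\<bar>t1 - l1 / l2 * t2\<bar> \<le> R + E + D + l1"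
      if z: "z \<in> C" "dist (fst z) (c1 t1) \<le> E" "dist (snd z) (c2 t2) \<le> E" for z t1 t2
    proof -
      \<comment> \<open>Moving back by \<open>k\<close> periods of \<alpha> brings the second
        coordinate near \<open>x2\<close>; \<open>R\<close> then bounds the first coordinate and
        hence \<open>t1 - k * l1\<close>.\<close>
      define k where "k = \<lfloor>t2 / l2\<rfloor>"
      have k: "\<bar>t2 / l2 - k\<bar> \<le> 1" unfolding k_def by linarith
      obtain h where h: "h \<in> carrier G" "\<And>t. \<rho>1 h (c1 t) = c1 (t - k * l1)" "\<And>t. \<rho>2 h (c2 t) = c2 (t - k * l2)"
        using shift[of "- k"] by auto
      let ?p = "(\<rho>1 h (fst z), \<rho>2 h (snd z))"
      have d: "dist (fst ?p) (c1 (t1 - k * l1)) \<le> E" "dist (snd ?p) (c2 (t2 - k * l2)) \<le> E"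
        using z isometry_dist[OF iso1[OF h(1)], of "fst z" "c1 t1"]
          isometry_dist[OF iso2[OF h(1)], of "snd z" "c2 t2"] h by simp_all
      have "t2 - k * l2 = (t2 / l2 - k) * l2" using c2(2) by (simp add: field_simps)
      then have "\<bar>t2 - k * l2\<bar> = \<bar>t2 / l2 - k\<bar> * l2" using c2(2) by (simp add: abs_mult)
      then have "dist (c2 (t2 - k * l2)) (c2 0) \<le> l2"
        using k c2(2) by (simp add: geodesic_lineD[OF line2] mult_left_le_one_le)
      then have "dist (snd ?p) x2 \<le> E + l2 + D"
        using d(2) D(2) dist_triangle[of "snd ?p" x2 "c2 (t2 - k * l2)"]
          dist_triangle[of "c2 (t2 - k * l2)" x2 "c2 0"] by (simp add: dist_commute)
      then have "dist (fst ?p) x1 \<le> R" using R inv[OF h(1) z(1)] by blast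
      then have "dist (c1 (t1 - k * l1)) (c1 0) \<le> E + R + D"
        using d(1) D(1) dist_triangle[of "c1 (t1 - k * l1)" "c1 0" x1]
          dist_triangle[of "c1 (t1 - k * l1)" x1 "fst ?p"] by (simp add: dist_commute)
      then have "\<bar>t1 - k * l1\<bar> \<le> E + R + D" by (simp add: geodesic_lineD[OF line1])
      moreover have "\<bar>l1 / l2 * t2 - k * l1\<bar> \<le> l1"
      proof -
        have "l1 / l2 * t2 - k * l1 = (t2 / l2 - k) * l1" by (simp add: algebra_simps)
        then show ?thesis using k c1(2) by (simp add: abs_mult mult_left_le_one_le)
      qed
      ultimately show ?thesis by linarith
    qed
    then show "\<exists>B. \<forall>z\<in>C. \<forall>t1 t2. dist (fst z) (c1 t1) \<le> E \<longrightarrow> dist (snd z) (c2 t2) \<le> E \<longrightarrow>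
      \<bar>t1 - l1 / l2 * t2\<bar> \<le> B" by blast
  qed (use assms(2,4) convex x c1(2) c2(2) D contracting_line_mono[OF c1(1)] contracting_line_mono[OF c2(1)]
      in \<open>simp_all add: CAT0_def\<close>)
  have "transl_len (\<rho>1 \<gamma>) = l1 / l2 * transl_len (\<rho>2 \<gamma>)" if \<gamma>: "\<gamma> \<in> carrier G" for \<gamma>
  proof -
    let ?a = "l1 / l2" and ?t1 = "transl_len (\<rho>1 \<gamma>)" and ?t2 = "transl_len (\<rho>2 \<gamma>)"
    define u1 u2 where "u1 k = dist x1 ((\<rho>1 \<gamma> ^^ (2 ^ k)) x1) / 2 ^ k"
      and "u2 k = dist x2 ((\<rho>2 \<gamma> ^^ (2 ^ k)) x2) / 2 ^ k" for k :: nat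
    have lim: "u1 \<longlonglongrightarrow> ?t1" "u2 \<longlonglongrightarrow> ?t2"
      unfolding u1_def u2_def using transl_len_LIMSEQ assms(2,4) iso1[OF \<gamma>] iso2[OF \<gamma>] by blast+
    \<comment> \<open>\<open>slope\<close> is applied to the orbit points of the base point under
      the powers \<open>2 ^ k\<close> of \<gamma>. Division by \<open>2 ^ k\<close> removes the
      constant \<open>N\<close> in the limit.\<close>
    have bound: "\<bar>?t1 - ?a * ?t2\<bar> \<le> \<epsilon> * (?t1 + ?t2)" if eps: "\<epsilon> > 0" for \<epsilon>
    proof -
      obtain N where N: "\<And>z. z \<in> C \<Longrightarrow> \<bar>dist x1 (fst z) - ?a * dist x2 (snd z)\<bar> \<le>
          \<epsilon> * (dist x1 (fst z) + dist x2 (snd z)) + N"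
        using slope[OF eps] by blast
      have le: "\<bar>u1 k - ?a * u2 k\<bar> \<le> \<epsilon> * (u1 k + u2 k) + N * (1 / 2) ^ k" for k
      proof -
        have "((\<rho>1 \<gamma> ^^ (2 ^ k)) x1, (\<rho>2 \<gamma> ^^ (2 ^ k)) x2) \<in> C"
          using inv[OF _ x, of "\<gamma> [^]\<^bsub>G\<^esub> ((2::nat) ^ k)"] \<gamma>
          by (simp add: isom_action_pow[OF assms(6)] isom_action_pow[OF assms(8)])
        from N[OF this] have "\<bar>2 ^ k * u1 k - ?a * (2 ^ k * u2 k)\<bar> \<le>
            \<epsilon> * (2 ^ k * u1 k + 2 ^ k * u2 k) + N"
          by (simp add: u1_def u2_def)
        also have "2 ^ k * u1 k - ?a * (2 ^ k * u2 k) = 2 ^ k * (u1 k - ?a * u2 k)"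
          by (simp add: algebra_simps)
        finally have "2 ^ k * \<bar>u1 k - ?a * u2 k\<bar> \<le> 2 ^ k * (\<epsilon> * (u1 k + u2 k) + N * (1 / 2) ^ k)"
          unfolding abs_mult by (simp add: power_divide distrib_left mult.left_commute)
        then show ?thesis by simp
      qed
      have "(\<lambda>k. \<bar>u1 k - ?a * u2 k\<bar>) \<longlonglongrightarrow> \<bar>?t1 - ?a * ?t2\<bar>"
        by (intro tendsto_intros lim)
      moreover have "(\<lambda>k. \<epsilon> * (u1 k + u2 k) + N * (1 / 2) ^ k) \<longlonglongrightarrow> \<epsilon> * (?t1 + ?t2) + N * 0"
        by (intro tendsto_intros lim LIMSEQ_power_zero) simp
      ultimately have "\<bar>?t1 - ?a * ?t2\<bar> \<le> \<epsilon> * (?t1 + ?t2) + N * 0"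
        using le by (intro LIMSEQ_le) blast+
      then show ?thesis by simp
    qed
    have "0 \<le> ?t1" "0 \<le> ?t2" by (simp_all add: transl_len_greatest)
    have "\<bar>?t1 - ?a * ?t2\<bar> \<le> 0 + e" if "e > 0" for e
    proof -
      \<comment> \<open>The summand 1 keeps the denominator positive when both translation lengths
        are 0.\<close>
      have "e / (?t1 + ?t2 + 1) > 0" using that \<open>0 \<le> ?t1\<close> \<open>0 \<le> ?t2\<close> by simp
      from bound[OF this] have "\<bar>?t1 - ?a * ?t2\<bar> \<le> e * ((?t1 + ?t2) / (?t1 + ?t2 + 1))" by simp
      also have "\<dots> \<le> e * 1"
        using that \<open>0 \<le> ?t1\<close> \<open>0 \<le> ?t2\<close> by (intro mult_left_mono) simp_all
      finally show ?thesis by simp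
    qed
    then have "\<bar>?t1 - ?a * ?t2\<bar> \<le> 0" by (rule field_le_epsilon)
    then show ?thesis by simp
  qed
  then show ?thesis using c1(2) c2(2) by (intro exI[of _ "l1 / l2"]) simp
qed

end
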